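(* Let $F_1,F_2\in\mathbb C^{(2n+m)\times(n+m)}$ be nonzero, $\alpha:=\|F_1\|_2$, $\beta:=\|F_2\|_2$, and $g(\gamma):=\big\|[\,\gamma F_1,\ F_2/\gamma\,]\big\|_2^2$ for $\gamma>0$. Then in the minimization problem $\min_{0<\gamma<\infty}g(\gamma)$ the infinite search interval can be replaced by the closed interval $[\gamma_{lo},\gamma_{up}]=\big[\sqrt{\beta/(2\alpha)},\sqrt{2\beta/\alpha}\big]$, i.e. $\inf_{\gamma>0}g(\gamma)=\min_{\gamma\in[\gamma_{lo},\gamma_{up}]}g(\gamma)$. Moreover, $g(\gamma^{gm})$ with $\gamma^{gm}:=\sqrt{\beta/\alpha}$ is an upper bound for this minimum.
   Context: $\|\cdot\|_2$ denotes the spectral norm (largest singular value); $[\,\gamma F_1,\ F_2/\gamma\,]$ is the horizontal concatenation of the two matrices. *)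

theory Defs
  imports "HOL-Analysis.Analysis"
begin

text \<open>Spectral norm (operator 2-norm) of a complex matrix: the operator norm of
  x \<mapsto> A x with respect to the Euclidean norms.\<close>
definition spec_norm :: "complex ^ 'c ^ 'r \<Rightarrow> real" where
  "spec_norm A = onorm (\<lambda>x. A *v x)"

text \<open>Horizontal concatenation [A, B] of two matrices with the same number of rows;
  the columns of A are indexed by Inl, those of B by Inr.\<close>
definition hcat :: "complex ^ 'c ^ 'r \<Rightarrow> complex ^ 'd ^ 'r \<Rightarrow> complex ^ ('c + 'd) ^ 'r" where
  "hcat A B = (\<chi> i j. case j of Inl k \<Rightarrow> A $ i $ k | Inr k \<Rightarrow> B $ i $ k)"

end

theory Submission
  imports Defs
begin

text \<open>The columns of \<open>[\<gamma> F\<^sub>1, F\<^sub>2/\<gamma>]\<close> contain those of \<open>\<gamma> F\<^sub>1\<close> and of \<open>F\<^sub>2/\<gamma>\<close>,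
  so \<open>max (\<gamma>\<alpha>, \<beta>/\<gamma>)\<^sup>2 \<le> g \<gamma> \<le> (\<gamma>\<alpha>)\<^sup>2 + (\<beta>/\<gamma>)\<^sup>2\<close>. At \<open>\<gamma> = \<surd>(\<beta>/\<alpha>)\<close> the upper bound
  equals \<open>2\<alpha>\<beta>\<close>, whereas outside \<open>[\<surd>(\<beta>/(2\<alpha>)), \<surd>(2\<beta>/\<alpha>)]\<close> one of the two lower bounds
  exceeds \<open>2\<alpha>\<beta>\<close>. Hence a minimiser of the continuous function \<open>g\<close> on this compact
  interval, which contains \<open>\<surd>(\<beta>/\<alpha>)\<close>, is a global minimiser on \<open>(0, \<infinity>)\<close>.\<close>

lemma scaleR_matrix_vector_mult:
  fixes A :: "'a::real_algebra_1 ^ 'c ^ 'r"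
  shows "(c *\<^sub>R A) *v x = c *\<^sub>R (A *v x)"
  by (simp add: vec_eq_iff matrix_vector_mult_def scaleR_sum_right)

lemma sum_UNIV_Plus:
  "(\<Sum>j\<in>UNIV. f j) = (\<Sum>k\<in>UNIV. f (Inl k)) + (\<Sum>k\<in>UNIV. f (Inr k))"
  for f :: "'a::finite + 'b::finite \<Rightarrow> 'x::comm_monoid_add"
  using sum.Plus[of "UNIV :: 'a set" "UNIV :: 'b set" f] by (simp add: UNIV_Plus_UNIV comp_def)

lemma norm_vec_Plus_squared:
  fixes y :: "'a::real_normed_vector ^ ('c::finite + 'd::finite)"
  shows "norm y ^ 2 = norm (\<chi> k. y $ Inl k) ^ 2 + norm (\<chi> k. y $ Inr k) ^ 2"
  by (simp add: norm_vec_def L2_set_def sum_nonneg sum_UNIV_Plus)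

lemma hcat_matrix_vector_mult:
  "hcat A B *v y = A *v (\<chi> k. y $ Inl k) + B *v (\<chi> k. y $ Inr k)"
  by (simp add: vec_eq_iff matrix_vector_mult_def sum_UNIV_Plus hcat_def)

lemma hcat_scaleR:
  "hcat (a *\<^sub>R A) (b *\<^sub>R B) = a *\<^sub>R hcat A 0 + b *\<^sub>R hcat 0 B"
  by (simp add: vec_eq_iff hcat_def split: sum.split)

lemma spec_norm_nonneg: "0 \<le> spec_norm A"
  by (simp add: spec_norm_def onorm_pos_le)

lemma spec_norm_pos: "A \<noteq> 0 \<Longrightarrow> 0 < spec_norm A"
  unfolding spec_norm_def
  by (metis matrix_eq matrix_vector_mult_0 onorm_pos_lt matrix_vector_mul_bounded_linear)

lemma spec_norm_scaleR: "spec_norm (c *\<^sub>R A) = \<bar>c\<bar> * spec_norm A"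
  by (simp add: spec_norm_def scaleR_matrix_vector_mult onorm_scaleR)

lemma norm_matrix_vector_mult_le: "norm (A *v x) \<le> spec_norm A * norm x"
  unfolding spec_norm_def by (rule onorm[OF matrix_vector_mul_bounded_linear])

lemma spec_norm_le:
  assumes "\<And>x. norm (A *v x) \<le> c * norm x" and "0 \<le> c"
  shows "spec_norm A \<le> c"
  unfolding spec_norm_def using assms by (intro onorm_bound)

lemma spec_norm_le_hcat_left:
  fixes A :: "complex ^ 'c ^ 'r" and B :: "complex ^ 'd ^ 'r"
  shows "spec_norm A \<le> spec_norm (hcat A B)"
proof (rule spec_norm_le[OF _ spec_norm_nonneg])
  fix x :: "complex ^ 'c"
  define y :: "complex ^ ('c + 'd)" where "y = (\<chi> j. case j of Inl k \<Rightarrow> x $ k | Inr _ \<Rightarrow> 0)"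
  have "A *v x = hcat A B *v y" and "norm y = norm x"
    using norm_vec_Plus_squared[of y]
    by (simp_all add: hcat_matrix_vector_mult y_def flip: zero_vec_def)
  then show "norm (A *v x) \<le> spec_norm (hcat A B) * norm x"
    by (metis norm_matrix_vector_mult_le)
qed

lemma spec_norm_le_hcat_right:
  fixes A :: "complex ^ 'c ^ 'r" and B :: "complex ^ 'd ^ 'r"
  shows "spec_norm B \<le> spec_norm (hcat A B)"
proof (rule spec_norm_le[OF _ spec_norm_nonneg])
  fix x :: "complex ^ 'd"
  define y :: "complex ^ ('c + 'd)" where "y = (\<chi> j. case j of Inl _ \<Rightarrow> 0 | Inr k \<Rightarrow> x $ k)"
  have "B *v x = hcat A B *v y" and "norm y = norm x"
    using norm_vec_Plus_squared[of y]
    by (simp_all add: hcat_matrix_vector_mult y_def flip: zero_vec_def)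
  then show "norm (B *v x) \<le> spec_norm (hcat A B) * norm x"
    by (metis norm_matrix_vector_mult_le)
qed

lemma spec_norm_hcat_le:
  fixes A :: "complex ^ 'c ^ 'r" and B :: "complex ^ 'd ^ 'r"
  shows "spec_norm (hcat A B) \<le> sqrt (spec_norm A ^ 2 + spec_norm B ^ 2)"
proof (rule spec_norm_le)
  fix y :: "complex ^ ('c + 'd)"
  let ?l = "\<chi> k. y $ Inl k" and ?r = "\<chi> k. y $ Inr k"
  have "norm (hcat A B *v y) \<le> norm (A *v ?l) + norm (B *v ?r)"
    by (simp add: hcat_matrix_vector_mult norm_triangle_ineq)
  also have "\<dots> \<le> spec_norm A * norm ?l + spec_norm B * norm ?r"
    by (intro add_mono norm_matrix_vector_mult_le)
  also have "\<dots> = inner (spec_norm A, spec_norm B) (norm ?l, norm ?r)"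
    by simp
  also have "\<dots> \<le> norm (spec_norm A, spec_norm B) * norm (norm ?l, norm ?r)"
    by (rule norm_cauchy_schwarz)
  also have "\<dots> = sqrt (spec_norm A ^ 2 + spec_norm B ^ 2) * norm y"
    by (simp add: norm_Pair norm_vec_Plus_squared[of y, symmetric])
  finally show "norm (hcat A B *v y) \<le> sqrt (spec_norm A ^ 2 + spec_norm B ^ 2) * norm y" .
qed simp

lemma spec_norm_hcat_squared_bounds:
  fixes A :: "complex ^ 'c ^ 'r" and B :: "complex ^ 'd ^ 'r"
  shows "max (spec_norm A ^ 2) (spec_norm B ^ 2) \<le> spec_norm (hcat A B) ^ 2"
    and "spec_norm (hcat A B) ^ 2 \<le> spec_norm A ^ 2 + spec_norm B ^ 2"
proof -
  show "max (spec_norm A ^ 2) (spec_norm B ^ 2) \<le> spec_norm (hcat A B) ^ 2"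
    using spec_norm_le_hcat_left[of A B] spec_norm_le_hcat_right[of B A]
    by (simp add: power_mono spec_norm_nonneg)
  show "spec_norm (hcat A B) ^ 2 \<le> spec_norm A ^ 2 + spec_norm B ^ 2"
    using power_mono[OF spec_norm_hcat_le spec_norm_nonneg, of A B 2] by simp
qed

lemma spec_norm_eq_norm_Blinfun: "spec_norm A = norm (Blinfun ((*v) A))"
  by (simp add: spec_norm_def norm_blinfun.rep_eq bounded_linear_Blinfun_apply)

lemma continuous_on_spec_norm_hcat_scaleR:
  fixes A :: "complex ^ 'c ^ 'r" and B :: "complex ^ 'd ^ 'r"
  assumes "continuous_on S a" and "continuous_on S b"
  shows "continuous_on S (\<lambda>t. spec_norm (hcat (a t *\<^sub>R A) (b t *\<^sub>R B)))"
proof -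
  have blinfun_combination: "spec_norm (hcat (a t *\<^sub>R A) (b t *\<^sub>R B))
      = norm (a t *\<^sub>R Blinfun ((*v) (hcat A 0)) + b t *\<^sub>R Blinfun ((*v) (hcat 0 B)))"
    for t
    unfolding spec_norm_eq_norm_Blinfun hcat_scaleR
    by (rule arg_cong[where f = norm], rule blinfun_eqI)
      (simp add: bounded_linear_Blinfun_apply matrix_vector_mult_add_rdistrib
        scaleR_matrix_vector_mult plus_blinfun.rep_eq scaleR_blinfun.rep_eq)
  show ?thesis
    unfolding blinfun_combination using assms by (intro continuous_intros)
qed

lemma two_mult_lt_max_outside_balanced_interval:
  fixes a b t :: real
  assumes "0 < a" "0 < b" "0 < t" "t \<notin> {sqrt (b / (2 * a)) .. sqrt (2 * b / a)}"
  shows "2 * a * b < max ((t * a) ^ 2) ((b / t) ^ 2)"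
proof (cases "t < sqrt (b / (2 * a))")
  case True
  then have "t ^ 2 < sqrt (b / (2 * a)) ^ 2"
    using \<open>0 < t\<close> by (intro power_strict_mono) auto
  then have "2 * a * t ^ 2 < b"
    using assms(1,2) by (simp add: field_simps)
  then have "b * (2 * a * t ^ 2) < b * b"
    using assms(2) by (rule mult_strict_left_mono)
  then have "2 * a * b < (b / t) ^ 2"
    using assms(3) by (simp add: power_divide field_simps power2_eq_square)
  then show ?thesis
    by simp
next
  case False
  then have "sqrt (2 * b / a) ^ 2 < t ^ 2"
    using assms(1,2,4) by (intro power_strict_mono) auto
  then have "2 * b < t ^ 2 * a"
    using assms(1,2) by (simp add: field_simps)
  then have "a * (2 * b) < a * (t ^ 2 * a)"
    using assms(1) by (rule mult_strict_left_mono)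
  then have "2 * a * b < (t * a) ^ 2"
    by (simp add: power_mult_distrib field_simps power2_eq_square)
  then show ?thesis
    by simp
qed

lemma balanced_interval_contains_minimiser:
  fixes f :: "real \<Rightarrow> real" and a b :: real
  assumes "0 < a" "0 < b"
    and "continuous_on {sqrt (b / (2 * a)) .. sqrt (2 * b / a)} f"
    and "\<And>t. 0 < t \<Longrightarrow> max ((t * a) ^ 2) ((b / t) ^ 2) \<le> f t"
    and "f (sqrt (b / a)) \<le> 2 * a * b"
  shows "\<exists>t0 \<in> {sqrt (b / (2 * a)) .. sqrt (2 * b / a)}. \<forall>t>0. f t0 \<le> f t"
proof -
  let ?I = "{sqrt (b / (2 * a)) .. sqrt (2 * b / a)}"
  have ratio_root_in: "sqrt (b / a) \<in> ?I"
    using assms(1,2) by (auto intro!: real_sqrt_le_mono simp: field_simps)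
  obtain t0 where t0: "t0 \<in> ?I" and min_on_I: "\<And>t. t \<in> ?I \<Longrightarrow> f t0 \<le> f t"
    using continuous_attains_inf[OF compact_Icc _ assms(3)] ratio_root_in by blast
  have "f t0 \<le> f t" if "0 < t" for t
  proof (cases "t \<in> ?I")
    case False
    have "f t0 \<le> 2 * a * b"
      using min_on_I[OF ratio_root_in] assms(5) by linarith
    also have "\<dots> < f t"
      using two_mult_lt_max_outside_balanced_interval[OF assms(1,2) that False] assms(4)[OF that] by linarith
    finally show ?thesis by simp
  qed (use min_on_I in blast)
  with t0 show ?thesis by blast
qed

theorem lemma10p1:
  fixes F1 F2 :: "complex ^ 'c ^ 'r" and n m :: nat
    and \<alpha> \<beta> :: real and g :: "real \<Rightarrow> real"
  assumes "CARD('r) = 2 * n + m" and "CARD('c) = n + m"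
    and "F1 \<noteq> 0" and "F2 \<noteq> 0"
    and "\<alpha> = spec_norm F1" and "\<beta> = spec_norm F2"
    and "\<And>\<gamma>. g \<gamma> = (spec_norm (hcat (\<gamma> *\<^sub>R F1) ((1 / \<gamma>) *\<^sub>R F2))) ^ 2"
  shows "\<exists>\<gamma>0 \<in> {sqrt (\<beta> / (2 * \<alpha>)) .. sqrt (2 * \<beta> / \<alpha>)}.
           g \<gamma>0 = (INF \<gamma>\<in>{0<..}. g \<gamma>)
         \<and> (\<forall>\<gamma>>0. g \<gamma>0 \<le> g \<gamma>)
         \<and> g \<gamma>0 \<le> g (sqrt (\<beta> / \<alpha>))"
proof -
  have "0 < \<alpha>" "0 < \<beta>"
    using assms(3-6) spec_norm_pos by auto
  have bounds: "max ((\<gamma> * \<alpha>) ^ 2) ((\<beta> / \<gamma>) ^ 2) \<le> g \<gamma>"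
    "g \<gamma> \<le> (\<gamma> * \<alpha>) ^ 2 + (\<beta> / \<gamma>) ^ 2" if "0 < \<gamma>" for \<gamma>
    using spec_norm_hcat_squared_bounds[of "\<gamma> *\<^sub>R F1" "(1 / \<gamma>) *\<^sub>R F2"] that
    by (simp_all add: assms(5-7) spec_norm_scaleR)
  have "g (sqrt (\<beta> / \<alpha>)) \<le> 2 * \<alpha> * \<beta>"
    using bounds(2)[of "sqrt (\<beta> / \<alpha>)"] \<open>0 < \<alpha>\<close> \<open>0 < \<beta>\<close>
    by (simp add: power_mult_distrib power_divide) (simp add: field_simps power2_eq_square)
  moreover have "continuous_on {sqrt (\<beta> / (2 * \<alpha>)) .. sqrt (2 * \<beta> / \<alpha>)} g"
    unfolding assms(7) using \<open>0 < \<alpha>\<close> \<open>0 < \<beta>\<close>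
    by (intro continuous_intros continuous_on_spec_norm_hcat_scaleR) (auto simp: field_simps)
  ultimately obtain \<gamma>0 where \<gamma>0_in: "\<gamma>0 \<in> {sqrt (\<beta> / (2 * \<alpha>)) .. sqrt (2 * \<beta> / \<alpha>)}"
    and min: "\<forall>\<gamma>>0. g \<gamma>0 \<le> g \<gamma>"
    using balanced_interval_contains_minimiser[OF \<open>0 < \<alpha>\<close> \<open>0 < \<beta>\<close> _ bounds(1)] by blast
  have "0 < sqrt (\<beta> / (2 * \<alpha>))"
    using \<open>0 < \<alpha>\<close> \<open>0 < \<beta>\<close> by simp
  then have "0 < \<gamma>0"
    using \<gamma>0_in by (meson atLeastAtMost_iff less_le_trans)
  then have "g \<gamma>0 = (INF \<gamma>\<in>{0<..}. g \<gamma>)"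
    using min by (intro cInf_eq_minimum[symmetric]) auto
  then show ?thesis
    using \<gamma>0_in min \<open>0 < \<alpha>\<close> \<open>0 < \<beta>\<close> by auto
qed

end
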